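(* Let $s\ge1$ be an integer and let $a:\mathbb{Z}^s\to\mathbb{C}$ be in $\ell^1(\mathbb{Z}^s)$, with $\widehat a(\theta)=\sum_{x\in\mathbb{Z}^s}a(x)e^{-\mathrm{i}x\cdot\theta}$ for $\theta\in\mathbb{T}^s=(-\pi,\pi]^s$. For $x\in\mathbb{Z}^s$ and $k\in\mathbb{N}=\{0,1,2,\dots\}$ define $$U(x,k)=\frac1{(2\pi)^s}\int_{\mathbb{T}^s}\rho(\theta)^k\,\widehat a(\theta)\,e^{\mathrm{i}x\cdot\theta}\,d\theta,$$ $$V_j(x,k)=\frac1{(2\pi)^s}\int_{\mathbb{T}^s}(-\mathrm{i}\,\operatorname{sgn}\theta_j)\,\omega_j(\theta)\,\rho(\theta)^{k+\frac12}\,e^{\mathrm{i}\theta_j/2}\,\widehat a(\theta)\,e^{\mathrm{i}x\cdot\theta}\,d\theta\qquad(j=1,\dots,s),$$ where $$\rho(\theta)=\alpha(\theta)-\sqrt{\alpha(\theta)^2-1},\qquad\alpha(\theta)=(s+1)-\sum_{j=1}^s\cos\theta_j,$$ $$\omega_j(\theta)=\frac{\operatorname{sgn}(\theta_j)\,\sin(\theta_j/2)}{\bigl(\sum_{i=1}^s\sin^2(\theta_i/2)\bigr)^{1/2}}\ \text{ for }\theta\ne0,\qquad\omega_j(0)=0.$$ Then for every $x\in\mathbb{Z}^s$ and $k\ge1$: $$\partial_k^+U(x,k)=-\sum_{j=1}^s\delta_{x_j}^-V_j(x,k),$$ $$\delta_{x_j}^+U(x,k)=\partial_k^-V_j(x,k)\qquad(j=1,\dots,s),$$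 $$\delta_{x_j}^+V_l(x,k)=\delta_{x_l}^+V_j(x,k)\qquad(j,l=1,\dots,s).$$
   Context: Let $e_j$ be the $j$th coordinate vector in $\mathbb{Z}^s$. For $F:\mathbb{Z}^s\times\mathbb{N}\to\mathbb{C}$, $x\in\mathbb{Z}^s$ and $k\ge1$, the difference operators are $\delta_{x_j}^+F(x,k)=F(x+e_j,k)-F(x,k)$, $\delta_{x_j}^-F(x,k)=F(x,k)-F(x-e_j,k)$, $\partial_k^+F(x,k)=F(x,k+1)-F(x,k)$, $\partial_k^-F(x,k)=F(x,k)-F(x,k-1)$. Convention: $\operatorname{sgn}0=0$. *)

theory Defs
  imports "HOL-Analysis.Analysis"
begin

text \<open>Throughout, the dimension \<open>s\<close> is \<open>CARD('s)\<close>, with coordinates indexed by \<open>'s\<close>;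
  \<open>axis j 1\<close> is the \<open>j\<close>th coordinate vector.\<close>

definition dx_plus :: "'s \<Rightarrow> (int ^ 's \<Rightarrow> nat \<Rightarrow> complex) \<Rightarrow> int ^ 's \<Rightarrow> nat \<Rightarrow> complex" where
  "dx_plus j F x k = F (x + axis j 1) k - F x k"

definition dx_minus :: "'s \<Rightarrow> (int ^ 's \<Rightarrow> nat \<Rightarrow> complex) \<Rightarrow> int ^ 's \<Rightarrow> nat \<Rightarrow> complex" where
  "dx_minus j F x k = F x k - F (x - axis j 1) k"

definition dk_plus :: "(int ^ 's \<Rightarrow> nat \<Rightarrow> complex) \<Rightarrow> int ^ 's \<Rightarrow> nat \<Rightarrow> complex" where
  "dk_plus F x k = F x (k + 1) - F x k"

text \<open>Only meaningful for \<open>k \<ge> 1\<close>, because subtraction on nat truncates.\<close>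

definition dk_minus :: "(int ^ 's \<Rightarrow> nat \<Rightarrow> complex) \<Rightarrow> int ^ 's \<Rightarrow> nat \<Rightarrow> complex" where
  "dk_minus F x k = F x k - F x (k - 1)"

definition torus :: "(real ^ 's) set" where
  "torus = {\<theta>. \<forall>j. - pi < \<theta> $ j \<and> \<theta> $ j \<le> pi}"

definition lattice_dot :: "int ^ 's \<Rightarrow> real ^ 's \<Rightarrow> real" where
  "lattice_dot x \<theta> = (\<Sum>j\<in>UNIV. real_of_int (x $ j) * \<theta> $ j)"

definition fourier :: "(int ^ 's \<Rightarrow> complex) \<Rightarrow> real ^ 's \<Rightarrow> complex" where
  "fourier a \<theta> = (\<Sum>\<^sub>\<infinity>x. a x * exp (- \<i> * of_real (lattice_dot x \<theta>)))"

definition alpha :: "real ^ 's \<Rightarrow> real" where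
  "alpha \<theta> = (real CARD('s) + 1) - (\<Sum>j\<in>UNIV. cos (\<theta> $ j))"

definition rho :: "real ^ 's \<Rightarrow> real" where
  "rho \<theta> = alpha \<theta> - sqrt ((alpha \<theta>)\<^sup>2 - 1)"

definition omega :: "'s \<Rightarrow> real ^ 's \<Rightarrow> real" where
  "omega j \<theta> = (if \<theta> = 0 then 0
     else sgn (\<theta> $ j) * sin (\<theta> $ j / 2) / sqrt (\<Sum>i\<in>UNIV. (sin (\<theta> $ i / 2))\<^sup>2))"

definition U :: "(int ^ 's \<Rightarrow> complex) \<Rightarrow> int ^ 's \<Rightarrow> nat \<Rightarrow> complex" where
  "U a x k = 1 / (2 * of_real pi) ^ CARD('s) *
     (LINT \<theta>:torus|lborel. of_real (rho \<theta> ^ k) * fourier a \<theta>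
        * exp (\<i> * of_real (lattice_dot x \<theta>)))"

definition V :: "(int ^ 's \<Rightarrow> complex) \<Rightarrow> 's \<Rightarrow> int ^ 's \<Rightarrow> nat \<Rightarrow> complex" where
  "V a j x k = 1 / (2 * of_real pi) ^ CARD('s) *
     (LINT \<theta>:torus|lborel. (- \<i> * of_real (sgn (\<theta> $ j))) * of_real (omega j \<theta>)
        * of_real (rho \<theta> powr (real k + 1 / 2)) * exp (\<i> * of_real (\<theta> $ j / 2))
        * fourier a \<theta> * exp (\<i> * of_real (lattice_dot x \<theta>)))"

end

theory Submission
  imports Defs
begin

text \<open>
  All the functions involved are inverse Fourier transforms of bounded symbols on the torus, and a
  shift by \<open>axis j 1\<close> multiplies the symbol by \<open>e\<^sup>i\<^sup>\<theta>\<^sup>j\<close>. So each identity reduces to a pointwise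
  identity of symbols. With \<open>S = (\<Sum>\<^sub>i sin\<^sup>2 (\<theta>\<^sub>i/2))\<^sup>1\<^sup>/\<^sup>2\<close> one has \<open>\<alpha> = 1 + 2 S\<^sup>2\<close>, whence
  \<open>\<rho>\<^sup>1\<^sup>/\<^sup>2 = (1 + S\<^sup>2)\<^sup>1\<^sup>/\<^sup>2 - S\<close> and \<open>\<rho> - 1 = - 2 S \<rho>\<^sup>1\<^sup>/\<^sup>2\<close>. Together with
  \<open>e\<^sup>i\<^sup>\<theta> - 1 = 2 i sin (\<theta>/2) e\<^sup>i\<^sup>\<theta>\<^sup>/\<^sup>2\<close> this gives the discrete Cauchy--Riemann system.
\<close>

section \<open>The half-sine norm and the decay factor \<open>rho\<close>\<close>

definition half_sine_norm :: "real ^ 's \<Rightarrow> real" where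
  "half_sine_norm \<theta> = sqrt (\<Sum>i\<in>UNIV. (sin (\<theta> $ i / 2))\<^sup>2)"

lemma half_sine_norm_nonneg: "half_sine_norm \<theta> \<ge> 0"
  by (simp add: half_sine_norm_def sum_nonneg)

lemma half_sine_norm_square: "(half_sine_norm \<theta>)\<^sup>2 = (\<Sum>i\<in>UNIV. (sin (\<theta> $ i / 2))\<^sup>2)"
  by (simp add: half_sine_norm_def sum_nonneg)

text \<open>This controls the quotient occurring in \<open>V\<close>: its modulus is at most 1, and
  its numerator vanishes wherever its denominator does, so the convention \<open>x / 0 = 0\<close>
  does no harm.\<close>

lemma abs_sin_le_half_sine_norm: "\<bar>sin (\<theta> $ j / 2)\<bar> \<le> half_sine_norm \<theta>"
proof -
  have "(sin (\<theta> $ j / 2))\<^sup>2 \<le> (\<Sum>i\<in>UNIV. (sin (\<theta> $ i / 2))\<^sup>2)"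
    by (rule member_le_sum) auto
  then show ?thesis
    unfolding half_sine_norm_def by (simp add: real_le_rsqrt)
qed

lemma alpha_eq: "alpha \<theta> = 1 + 2 * (half_sine_norm \<theta>)\<^sup>2"
proof -
  have "cos t = 1 - 2 * (sin (t / 2))\<^sup>2" for t :: real
    using cos_double_sin[of "t / 2"] by simp
  then have "(\<Sum>j\<in>UNIV. cos (\<theta> $ j)) = (\<Sum>j\<in>UNIV. 1 - 2 * (sin (\<theta> $ j / 2))\<^sup>2)"
    by simp
  then show ?thesis
    by (simp add: alpha_def half_sine_norm_square sum_subtractf sum_distrib_left)
qed

text \<open>With S the half-sine norm, \<open>alpha^2 - 1\<close> factors as 2 S^2 (2 + 2 S^2), so
  \<open>rho\<close> is 1 + 2 S^2 - 2 S sqrt(1 + S^2), which is a perfect square.\<close>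

lemma rho_eq: "rho \<theta> = (sqrt (1 + (half_sine_norm \<theta>)\<^sup>2) - half_sine_norm \<theta>)\<^sup>2"
proof -
  let ?S = "half_sine_norm \<theta>"
  have "(alpha \<theta>)\<^sup>2 - 1 = (2 * ?S)\<^sup>2 * (1 + ?S\<^sup>2)"
    by (simp add: alpha_eq power2_eq_square algebra_simps)
  then have "sqrt ((alpha \<theta>)\<^sup>2 - 1) = 2 * ?S * sqrt (1 + ?S\<^sup>2)"
    by (simp add: real_sqrt_mult half_sine_norm_nonneg)
  moreover have "(sqrt (1 + ?S\<^sup>2))\<^sup>2 = 1 + ?S\<^sup>2"
    by simp
  ultimately show ?thesis
    by (simp add: rho_def alpha_eq power2_diff)
qed

text \<open>Fixes the sign of the base in \<open>rho_eq\<close>: strictness makes \<open>rho\<close>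
  positive and selects the right root in \<open>sqrt_rho\<close>.\<close>

lemma half_sine_norm_less: "half_sine_norm \<theta> < sqrt (1 + (half_sine_norm \<theta>)\<^sup>2)"
  by (rule real_less_rsqrt) simp

lemma rho_pos: "rho \<theta> > 0"
  using half_sine_norm_less[of \<theta>] by (simp add: rho_eq)

lemma sqrt_rho: "sqrt (rho \<theta>) = sqrt (1 + (half_sine_norm \<theta>)\<^sup>2) - half_sine_norm \<theta>"
  using half_sine_norm_less[of \<theta>] by (simp add: rho_eq)

text \<open>The number r = sqrt(1 + S^2) - S is the positive root of r^2 + 2 S r - 1 = 0, and r^2 is
  \<open>rho\<close>.\<close>

lemma rho_minus_1: "rho \<theta> - 1 = - 2 * half_sine_norm \<theta> * sqrt (rho \<theta>)"
proof -
  have "(sqrt (1 + (half_sine_norm \<theta>)\<^sup>2))\<^sup>2 = 1 + (half_sine_norm \<theta>)\<^sup>2"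
    by simp
  then show ?thesis
    unfolding sqrt_rho by (simp add: rho_eq power2_eq_square algebra_simps)
qed

lemma rho_le_1: "rho \<theta> \<le> 1"
proof -
  have "half_sine_norm \<theta> * sqrt (rho \<theta>) \<ge> 0"
    using half_sine_norm_nonneg[of \<theta>] rho_pos[of \<theta>] by simp
  then show ?thesis
    using rho_minus_1[of \<theta>] by simp
qed

lemma rho_powr_half: "rho \<theta> powr (real k + 1 / 2) = rho \<theta> ^ k * sqrt (rho \<theta>)"
  using rho_pos[of \<theta>] by (simp add: powr_add powr_realpow powr_half_sqrt)

lemma rho_measurable [measurable]: "rho \<in> borel_measurable borel"
  unfolding rho_def alpha_def by (intro borel_measurable_continuous_onI continuous_intros)

lemma half_sine_norm_measurable [measurable]: "half_sine_norm \<in> borel_measurable borel"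
  unfolding half_sine_norm_def by (intro borel_measurable_continuous_onI continuous_intros) auto

text \<open>At \<open>\<theta> $ j = 0\<close> both sides vanish, at \<open>\<theta> = 0\<close> because the right-hand side is \<open>0 / 0 = 0\<close>.\<close>

lemma sgn_omega: "sgn (\<theta> $ j) * omega j \<theta> = sin (\<theta> $ j / 2) / half_sine_norm \<theta>"
  by (cases "\<theta> $ j = 0") (auto simp: omega_def half_sine_norm_def sgn_if)

section \<open>Half-angle identities for exponentials\<close>

lemma exp_i_minus_1:
  fixes t :: real
  shows "exp (\<i> * of_real t) - 1 = 2 * \<i> * of_real (sin (t / 2)) * exp (\<i> * of_real (t / 2))"
proof -
  have "exp (\<i> * of_real t) = exp (\<i> * of_real (t / 2)) * exp (\<i> * of_real (t / 2))"
    by (simp flip: exp_add)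
  moreover have "exp (- (\<i> * of_real (t / 2))) * exp (\<i> * of_real (t / 2)) = 1"
    by (simp flip: exp_add)
  moreover have "2 * \<i> * of_real (sin (t / 2))
      = exp (\<i> * of_real (t / 2)) - exp (- (\<i> * of_real (t / 2)))"
    by (simp add: sin_of_real [symmetric] sin_exp_eq field_simps)
  ultimately show ?thesis
    by (simp add: left_diff_distrib)
qed

text \<open>The factor exp(i t / 2) built into \<open>V\<close> centres the backward difference, so
  that no phase remains.\<close>

lemma one_minus_exp_i:
  fixes t :: real
  shows "(1 - exp (- (\<i> * of_real t))) * exp (\<i> * of_real (t / 2)) = 2 * \<i> * of_real (sin (t / 2))"
proof -
  have "(1 - exp (- (\<i> * of_real t))) * exp (\<i> * of_real (t / 2))
      = exp (\<i> * of_real (t / 2)) - exp (- (\<i> * of_real (t / 2)))"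
    by (simp add: left_diff_distrib flip: exp_add)
  also have "\<dots> = 2 * \<i> * of_real (sin (t / 2))"
    by (simp add: sin_of_real [symmetric] sin_exp_eq field_simps)
  finally show ?thesis .
qed

section \<open>Characters, the torus, and the Fourier series of a summable sequence\<close>

lemma lattice_dot_add: "lattice_dot (x + y) \<theta> = lattice_dot x \<theta> + lattice_dot y \<theta>"
  by (simp add: lattice_dot_def distrib_right sum.distrib)

lemma lattice_dot_uminus: "lattice_dot (- y) \<theta> = - lattice_dot y \<theta>"
  by (simp add: lattice_dot_def sum_negf)

lemma lattice_dot_axis: "lattice_dot (axis j 1) \<theta> = \<theta> $ j"
proof -
  have "lattice_dot (axis j 1) \<theta> = (\<Sum>i\<in>UNIV. if i = j then \<theta> $ i else 0)"
    unfolding lattice_dot_def by (intro sum.cong) (auto simp: axis_def)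
  then show ?thesis
    by simp
qed

lemma continuous_on_lattice_dot [continuous_intros]: "continuous_on A (lattice_dot x)"
  unfolding lattice_dot_def by (intro continuous_intros)

lemma lattice_dot_measurable [measurable]: "lattice_dot x \<in> borel_measurable borel"
  by (intro borel_measurable_continuous_onI continuous_intros)

lemma torus_measurable [measurable]: "torus \<in> sets borel"
  unfolding torus_def by measurable

lemma bounded_torus: "bounded torus"
proof (rule bounded_subset)
  show "torus \<subseteq> cbox (\<chi> i. - pi) (\<chi> i. pi)"
    by (auto simp: torus_def mem_box_cart less_imp_le)
qed (rule bounded_cbox)

text \<open>The symbol of \<open>V\<close> is in general discontinuous at \<theta> = 0, so
  integrability is drawn from measurability, boundedness and the finite measure of the
  torus.\<close>

lemma set_integrable_torus_bounded:
  fixes f :: "real ^ 's \<Rightarrow> complex"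
  assumes [measurable]: "f \<in> borel_measurable borel" and "\<And>\<theta>. norm (f \<theta>) \<le> B"
  shows "set_integrable lborel torus f"
  unfolding set_integrable_def
proof (rule integrableI_bounded_set_indicator)
  show "emeasure lborel torus < \<infinity>"
    by (rule emeasure_bounded_finite[OF bounded_torus])
qed (use assms in auto)

text \<open>Characters have modulus 1, so \<open>norm (a x)\<close> is a summable majorant and the
  finite partial sums, being continuous, converge uniformly.\<close>

lemma fourier_continuous:
  assumes "(\<lambda>y. norm (a y)) summable_on UNIV"
  shows "continuous_on UNIV (fourier a)"
proof -
  have "uniform_limit UNIV (\<lambda>X \<theta>. \<Sum>x\<in>X. a x * exp (- \<i> * of_real (lattice_dot x \<theta>)))
      (\<lambda>\<theta>. \<Sum>\<^sub>\<infinity>x\<in>UNIV. a x * exp (- \<i> * of_real (lattice_dot x \<theta>))) (finite_subsets_at_top UNIV)"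
    by (rule Weierstrass_m_test_general[OF _ assms]) (simp add: norm_mult)
  then have "continuous_on UNIV (\<lambda>\<theta>. \<Sum>\<^sub>\<infinity>x\<in>UNIV. a x * exp (- \<i> * of_real (lattice_dot x \<theta>)))"
    by (rule uniform_limit_theorem[rotated]) (auto intro!: always_eventually continuous_intros)
  then show ?thesis
    by (simp add: fourier_def[abs_def])
qed

lemma norm_fourier_le:
  assumes "(\<lambda>y. norm (a y)) summable_on UNIV"
  shows "norm (fourier a \<theta>) \<le> (\<Sum>\<^sub>\<infinity>y. norm (a y))"
  using norm_infsum_bound[of "\<lambda>x. a x * exp (- \<i> * of_real (lattice_dot x \<theta>))" UNIV] assms
  by (simp add: fourier_def norm_mult)

lemma fourier_measurable:
  assumes "(\<lambda>y. norm (a y)) summable_on UNIV"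
  shows "fourier a \<in> borel_measurable borel"
  by (rule borel_measurable_continuous_onI[OF fourier_continuous[OF assms]])

section \<open>The inverse transform turns differences in x into multipliers\<close>

definition inv_fourier :: "(real ^ 's \<Rightarrow> complex) \<Rightarrow> int ^ 's \<Rightarrow> complex" where
  "inv_fourier m x = 1 / (2 * of_real pi) ^ CARD('s) *
     (LINT \<theta>:torus|lborel. m \<theta> * exp (\<i> * of_real (lattice_dot x \<theta>)))"

lemma set_integrable_mult_character:
  fixes m :: "real ^ 's \<Rightarrow> complex"
  assumes "set_integrable lborel torus m"
  shows "set_integrable lborel torus (\<lambda>\<theta>. m \<theta> * exp (\<i> * of_real (lattice_dot x \<theta>)))"
proof -
  \<comment> \<open>Set integrability yields measurability of \<open>m\<close> only after cutting
    off by the indicator, so the character is multiplied onto the cut-off function.\<close>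
  have [measurable]: "(\<lambda>\<theta>. indicator torus \<theta> *\<^sub>R m \<theta>) \<in> borel_measurable borel"
    using borel_measurable_integrable[OF assms[unfolded set_integrable_def]] by simp
  have "integrable lborel
      (\<lambda>\<theta>. (indicator torus \<theta> *\<^sub>R m \<theta>) * exp (\<i> * of_real (lattice_dot x \<theta>)))"
    by (rule Bochner_Integration.integrable_bound[OF assms[unfolded set_integrable_def]])
      (simp_all add: norm_mult flip: mult_scaleR_left)
  then show ?thesis
    by (simp add: set_integrable_def)
qed

lemma inv_fourier_diff:
  assumes "set_integrable lborel torus m" "set_integrable lborel torus n"
  shows "inv_fourier m x - inv_fourier n x = inv_fourier (\<lambda>\<theta>. m \<theta> - n \<theta>) x"
  using set_integral_diff(2)[OF assms[THEN set_integrable_mult_character[where x = x]]]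
  by (simp add: inv_fourier_def left_diff_distrib right_diff_distrib)

lemma inv_fourier_sum:
  assumes "finite J" "\<And>j. j \<in> J \<Longrightarrow> set_integrable lborel torus (m j)"
  shows "(\<Sum>j\<in>J. inv_fourier (m j) x) = inv_fourier (\<lambda>\<theta>. \<Sum>j\<in>J. m j \<theta>) x"
proof -
  have "(\<Sum>j\<in>J. LINT \<theta>:torus|lborel. m j \<theta> * exp (\<i> * of_real (lattice_dot x \<theta>)))
      = (LINT \<theta>:torus|lborel. \<Sum>j\<in>J. m j \<theta> * exp (\<i> * of_real (lattice_dot x \<theta>)))"
    using set_integrable_mult_character[OF assms(2), where x = x]
    unfolding set_lebesgue_integral_def set_integrable_def scaleR_sum_right
    by (intro Bochner_Integration.integral_sum [symmetric])
  then show ?thesis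
    unfolding inv_fourier_def sum_distrib_right by (simp flip: sum_distrib_left sum_divide_distrib)
qed

lemma inv_fourier_uminus: "inv_fourier (\<lambda>\<theta>. - m \<theta>) x = - inv_fourier m x"
  by (simp add: inv_fourier_def set_lebesgue_integral_def)

lemma inv_fourier_shift:
  "inv_fourier m (x + y) = inv_fourier (\<lambda>\<theta>. exp (\<i> * of_real (lattice_dot y \<theta>)) * m \<theta>) x"
  by (simp add: inv_fourier_def lattice_dot_add distrib_left exp_add mult_ac)

lemma inv_fourier_forward_diff:
  assumes "set_integrable lborel torus m"
  shows "inv_fourier m (x + axis j 1) - inv_fourier m x
    = inv_fourier (\<lambda>\<theta>. (exp (\<i> * of_real (\<theta> $ j)) - 1) * m \<theta>) x"
  using inv_fourier_diff[OF set_integrable_mult_character[OF assms, where x = "axis j 1"] assms]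
  by (simp add: inv_fourier_shift lattice_dot_axis left_diff_distrib right_diff_distrib mult.commute)

text \<open>Supplies the termwise integrability that lets the sum over all directions pass under the
  integral in the first equation.\<close>

lemma backward_symbol_integrable:
  assumes "set_integrable lborel torus m"
  shows "set_integrable lborel torus (\<lambda>\<theta>. (1 - exp (- (\<i> * of_real (\<theta> $ j)))) * m \<theta>)"
  using set_integral_diff(1)[OF assms
      set_integrable_mult_character[OF assms, where x = "- axis j 1"]]
  by (simp add: lattice_dot_uminus lattice_dot_axis left_diff_distrib right_diff_distrib mult.commute)

lemma inv_fourier_backward_diff:
  assumes "set_integrable lborel torus m"
  shows "inv_fourier m x - inv_fourier m (x - axis j 1)
    = inv_fourier (\<lambda>\<theta>. (1 - exp (- (\<i> * of_real (\<theta> $ j)))) * m \<theta>) x"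
  using inv_fourier_diff[OF assms set_integrable_mult_character[OF assms, where x = "- axis j 1"]]
    inv_fourier_shift[of m x "- axis j 1"]
  by (simp add: lattice_dot_uminus lattice_dot_axis left_diff_distrib right_diff_distrib mult.commute)

section \<open>Symbols of \<open>U\<close> and \<open>V\<close>, their bounds and
  integrability\<close>

definition U_symbol :: "(int ^ 's \<Rightarrow> complex) \<Rightarrow> nat \<Rightarrow> real ^ 's \<Rightarrow> complex" where
  "U_symbol a k \<theta> = of_real (rho \<theta> ^ k) * fourier a \<theta>"

text \<open>The half power of \<open>rho\<close> is split off as a square root so that
  \<open>U_symbol\<close> appears as a common factor; every identity then reduces to one between
  scalar multipliers.\<close>

definition V_symbol :: "(int ^ 's \<Rightarrow> complex) \<Rightarrow> 's \<Rightarrow> nat \<Rightarrow> real ^ 's \<Rightarrow> complex" where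
  "V_symbol a j k \<theta> = - \<i> * of_real (sin (\<theta> $ j / 2) / half_sine_norm \<theta> * sqrt (rho \<theta>))
     * exp (\<i> * of_real (\<theta> $ j / 2)) * U_symbol a k \<theta>"

lemma U_eq: "U a x k = inv_fourier (U_symbol a k) x"
  by (simp add: U_def inv_fourier_def U_symbol_def)

lemma V_eq: "V a j x k = inv_fourier (V_symbol a j k) x"
proof -
  have "(- \<i> * of_real (sgn (\<theta> $ j))) * of_real (omega j \<theta>)
      * of_real (rho \<theta> powr (real k + 1 / 2)) * exp (\<i> * of_real (\<theta> $ j / 2)) * fourier a \<theta>
      = V_symbol a j k \<theta>" for \<theta>
  proof -
    have "(- \<i> * of_real (sgn (\<theta> $ j))) * of_real (omega j \<theta>)
        * of_real (rho \<theta> powr (real k + 1 / 2)) * exp (\<i> * of_real (\<theta> $ j / 2)) * fourier a \<theta>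
        = - \<i> * of_real ((sgn (\<theta> $ j) * omega j \<theta>) * (rho \<theta> ^ k * sqrt (rho \<theta>)))
          * exp (\<i> * of_real (\<theta> $ j / 2)) * fourier a \<theta>"
      by (simp only: rho_powr_half of_real_mult mult_ac)
    then show ?thesis
      unfolding sgn_omega V_symbol_def U_symbol_def by (simp only: of_real_mult mult_ac)
  qed
  then show ?thesis
    by (simp only: V_def inv_fourier_def)
qed

lemma norm_U_symbol_le:
  assumes "(\<lambda>y. norm (a y)) summable_on UNIV"
  shows "norm (U_symbol a k \<theta>) \<le> (\<Sum>\<^sub>\<infinity>y. norm (a y))"
proof -
  have "rho \<theta> ^ k \<le> 1"
    using rho_pos[of \<theta>] rho_le_1[of \<theta>] by (simp add: power_le_one)
  then have "rho \<theta> ^ k * norm (fourier a \<theta>) \<le> 1 * (\<Sum>\<^sub>\<infinity>y. norm (a y))"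
    using norm_fourier_le[OF assms] by (intro mult_mono) auto
  then show ?thesis
    using rho_pos[of \<theta>] by (simp add: U_symbol_def norm_mult norm_power)
qed

lemma U_symbol_measurable:
  assumes "(\<lambda>y. norm (a y)) summable_on UNIV"
  shows "U_symbol a k \<in> borel_measurable borel"
  using fourier_measurable[OF assms, measurable] unfolding U_symbol_def by measurable

lemma U_symbol_integrable:
  assumes "(\<lambda>y. norm (a y)) summable_on UNIV"
  shows "set_integrable lborel torus (U_symbol a k)"
  by (rule set_integrable_torus_bounded[OF U_symbol_measurable[OF assms] norm_U_symbol_le[OF assms]])

lemma V_symbol_integrable:
  fixes a :: "int ^ 's \<Rightarrow> complex"
  assumes "(\<lambda>y. norm (a y)) summable_on UNIV"
  shows "set_integrable lborel torus (V_symbol a j k)"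
proof (rule set_integrable_torus_bounded)
  note U_symbol_measurable[OF assms, measurable]
  show "V_symbol a j k \<in> borel_measurable borel"
    unfolding V_symbol_def by measurable
next
  fix \<theta> :: "real ^ 's"
  have "\<bar>sin (\<theta> $ j / 2) / half_sine_norm \<theta>\<bar> \<le> 1"
    using abs_sin_le_half_sine_norm[of \<theta> j] half_sine_norm_nonneg[of \<theta>]
    by (auto simp: divide_le_eq_1)
  moreover have "\<bar>sqrt (rho \<theta>)\<bar> \<le> 1"
    using rho_pos[of \<theta>] rho_le_1[of \<theta>] by simp
  ultimately have "\<bar>sin (\<theta> $ j / 2) / half_sine_norm \<theta>\<bar> * \<bar>sqrt (rho \<theta>)\<bar> \<le> 1"
    by (intro mult_le_one) auto
  then have "\<bar>sin (\<theta> $ j / 2) / half_sine_norm \<theta> * sqrt (rho \<theta>)\<bar> * norm (U_symbol a k \<theta>)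
      \<le> 1 * (\<Sum>\<^sub>\<infinity>y. norm (a y))"
    using norm_U_symbol_le[OF assms] by (intro mult_mono) (auto simp: abs_mult)
  then show "norm (V_symbol a j k \<theta>) \<le> (\<Sum>\<^sub>\<infinity>y. norm (a y))"
    by (simp only: V_symbol_def norm_mult norm_of_real norm_minus_cancel norm_ii norm_exp_i_times
        mult_1 mult_1_right)
qed

section \<open>Pointwise identities between the symbols\<close>

lemma U_symbol_Suc: "U_symbol a (Suc k) \<theta> = of_real (rho \<theta>) * U_symbol a k \<theta>"
  by (simp add: U_symbol_def)

text \<open>Direction j contributes a multiple of its squared half-sine. The squares add up to S^2,
  one S cancels against the denominator, and the remaining 2 S sqrt(\<open>rho\<close>) is 1 -
  \<open>rho\<close>.\<close>

lemma U_symbol_time_diff: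
  "U_symbol a (Suc k) \<theta> - U_symbol a k \<theta>
    = - (\<Sum>j\<in>UNIV. (1 - exp (- (\<i> * of_real (\<theta> $ j)))) * V_symbol a j k \<theta>)"
proof -
  let ?S = "half_sine_norm \<theta>"
  have "(1 - exp (- (\<i> * of_real (\<theta> $ j)))) * V_symbol a j k \<theta>
      = of_real ((sin (\<theta> $ j / 2))\<^sup>2 * (2 * sqrt (rho \<theta>) / ?S)) * U_symbol a k \<theta>" for j
  proof -
    have "(1 - exp (- (\<i> * of_real (\<theta> $ j)))) * V_symbol a j k \<theta>
        = ((1 - exp (- (\<i> * of_real (\<theta> $ j)))) * exp (\<i> * of_real (\<theta> $ j / 2)))
          * (- \<i> * of_real (sin (\<theta> $ j / 2) / ?S * sqrt (rho \<theta>))) * U_symbol a k \<theta>"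
      by (simp only: V_symbol_def mult_ac)
    also have "\<dots> = of_real ((sin (\<theta> $ j / 2))\<^sup>2 * (2 * sqrt (rho \<theta>) / ?S)) * U_symbol a k \<theta>"
      unfolding one_minus_exp_i by (simp add: power2_eq_square mult_ac complex_i_mult_minus)
    finally show ?thesis .
  qed
  then have "(\<Sum>j\<in>UNIV. (1 - exp (- (\<i> * of_real (\<theta> $ j)))) * V_symbol a j k \<theta>)
      = of_real (?S\<^sup>2 * (2 * sqrt (rho \<theta>) / ?S)) * U_symbol a k \<theta>"
    by (simp only: half_sine_norm_square sum_distrib_right of_real_sum)
  \<comment> \<open>For S = 0 the left side is 0 by the division convention, and
    \<open>rho_minus_1\<close> gives \<open>rho\<close> = 1.\<close>
  also have "?S\<^sup>2 * (2 * sqrt (rho \<theta>) / ?S) = 1 - rho \<theta>"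
    using rho_minus_1[of \<theta>] by (cases "?S = 0") (simp_all add: power2_eq_square)
  finally show ?thesis
    by (simp add: U_symbol_Suc left_diff_distrib)
qed

text \<open>The time step of \<open>V_symbol\<close> produces \<open>rho\<close> - 1 = -2 S
  sqrt(\<open>rho\<close>). Its S cancels the denominator and its root completes the half power to
  \<open>rho\<close>, which raises the time index of \<open>U_symbol\<close> by one.\<close>

lemma U_symbol_space_diff:
  "(exp (\<i> * of_real (\<theta> $ j)) - 1) * U_symbol a (Suc k) \<theta>
    = V_symbol a j (Suc k) \<theta> - V_symbol a j k \<theta>"
proof -
  let ?S = "half_sine_norm \<theta>"
  let ?E = "exp (\<i> * of_real (\<theta> $ j / 2))"
  have sin_eq: "sin (\<theta> $ j / 2) / ?S * sqrt (rho \<theta>) * (rho \<theta> - 1) = - 2 * sin (\<theta> $ j / 2) * rho \<theta>"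
  proof (cases "?S = 0")
    \<comment> \<open>Here every half-sine is 0, so both sides vanish.\<close>
    case True
    then show ?thesis
      using abs_sin_le_half_sine_norm[of \<theta> j] by simp
  next
    case False
    have "sqrt (rho \<theta>) * sqrt (rho \<theta>) = rho \<theta>"
      using rho_pos[of \<theta>] by simp
    with False show ?thesis
      by (simp add: rho_minus_1)
  qed
  have "V_symbol a j (Suc k) \<theta> - V_symbol a j k \<theta>
      = - \<i> * of_real (sin (\<theta> $ j / 2) / ?S * sqrt (rho \<theta>) * (rho \<theta> - 1)) * ?E * U_symbol a k \<theta>"
    unfolding V_symbol_def U_symbol_Suc of_real_mult of_real_diff of_real_1
    by (simp only: algebra_simps mult_1)
  also have "\<dots> = (exp (\<i> * of_real (\<theta> $ j)) - 1) * U_symbol a (Suc k) \<theta>"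
    unfolding sin_eq exp_i_minus_1 U_symbol_Suc by simp
  finally show ?thesis ..
qed

text \<open>Up to a factor independent of the direction, \<open>V_symbol\<close> in direction j is
  exp(i \<theta>_j) - 1, so each side is a product symmetric in j and l, as for a discrete
  gradient.\<close>

lemma V_symbol_symmetric:
  "(exp (\<i> * of_real (\<theta> $ j)) - 1) * V_symbol a l k \<theta>
    = (exp (\<i> * of_real (\<theta> $ l)) - 1) * V_symbol a j k \<theta>"
  unfolding exp_i_minus_1 V_symbol_def by simp

theorem proposition5p1:
  fixes a :: "int ^ 's \<Rightarrow> complex" and x :: "int ^ 's" and k :: nat
  assumes "(\<lambda>y. norm (a y)) summable_on UNIV" and "k \<ge> 1"
  shows "dk_plus (U a) x k = - (\<Sum>j\<in>UNIV. dx_minus j (V a j) x k)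
    \<and> (\<forall>j. dx_plus j (U a) x k = dk_minus (V a j) x k)
    \<and> (\<forall>j l. dx_plus j (V a l) x k = dx_plus l (V a j) x k)"
proof (intro conjI allI)
  note U_int = U_symbol_integrable[OF assms(1)] and V_int = V_symbol_integrable[OF assms(1)]
  have "(\<Sum>j\<in>UNIV. dx_minus j (V a j) x k)
      = (\<Sum>j\<in>UNIV. inv_fourier (\<lambda>\<theta>. (1 - exp (- (\<i> * of_real (\<theta> $ j)))) * V_symbol a j k \<theta>) x)"
    by (simp only: dx_minus_def V_eq inv_fourier_backward_diff[OF V_int])
  also have "\<dots> = inv_fourier
      (\<lambda>\<theta>. \<Sum>j\<in>UNIV. (1 - exp (- (\<i> * of_real (\<theta> $ j)))) * V_symbol a j k \<theta>) x"
    by (rule inv_fourier_sum) (auto intro: backward_symbol_integrable[OF V_int])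
  finally show "dk_plus (U a) x k = - (\<Sum>j\<in>UNIV. dx_minus j (V a j) x k)"
    by (simp add: dk_plus_def U_eq inv_fourier_diff[OF U_int U_int] U_symbol_time_diff
        inv_fourier_uminus)
next
  fix j
  \<comment> \<open>Positivity of k makes the truncated \<open>k - 1\<close> a genuine predecessor,
    as the symbol identity at \<open>Suc k'\<close> requires.\<close>
  obtain k' where k': "k = Suc k'"
    using assms(2) by (cases k) auto
  show "dx_plus j (U a) x k = dk_minus (V a j) x k"
    by (simp add: k' dx_plus_def dk_minus_def U_eq V_eq U_symbol_space_diff
        inv_fourier_forward_diff[OF U_symbol_integrable[OF assms(1)]]
        inv_fourier_diff[OF V_symbol_integrable[OF assms(1)] V_symbol_integrable[OF assms(1)]])
next
  fix j l
  show "dx_plus j (V a l) x k = dx_plus l (V a j) x k"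
    by (simp only: dx_plus_def V_eq inv_fourier_forward_diff[OF V_symbol_integrable[OF assms(1)]]
        V_symbol_symmetric[of _ j])
qed

end
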